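(* Let $0<q<1$ and $\alpha>-1$, and let $j^{(2)}_{1,\alpha}$ be the smallest positive zero of $\mathcal{J}^{(2)}_\alpha(\cdot;q^2)$. Let $f(z)=\sum_{n=0}^\infty f_nz^n$ be a function satisfying $$\lim_{n\to\infty}\sqrt[n]{\left|\frac{f_n}{\Psi_n}\right|}=\tau,\qquad \Psi_n=\frac{q^{\frac{n(n-1)}{2}}}{[n]_q!},\qquad 0\le\tau<\min\left\{\frac{2}{1-q},\frac{j^{(2)}_{1,\alpha}}{1-q}\right\}.$$ Then $$f(z)=\sum_{n=0}^\infty L_n(f)\,\frac{B^{(2)}_{n,\alpha}(z;q)}{[n]_q!}\qquad(z\in\mathbb{C}),$$ where, for $n\in\mathbb{N}_0$, $$L_n(f)=(1-q)^{-n}\sum_{k=n}^\infty f_k\,\frac{q^{-\frac{k(k-1)}{2}}\,(q;q)_k\,(q^{2\alpha+1};q^2)_{k-n}\,\left(\tfrac12\right)^{k-n}}{(q;q)_{k-n}\,(q^{2\alpha+1};q)_{k-n}}.$$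
   Context: Notation: $(a;q)_n=\prod_{k=0}^{n-1}(1-aq^k)$, $(a;q)_0=1$; $[n]_q=\frac{1-q^n}{1-q}$; $[n]_q!=\prod_{k=1}^n[k]_q$; $\mathbb{N}_0=\{0,1,2,\dots\}$. The $q$-exponential is the entire function $E_q(z)=\sum_{n\ge0}q^{n(n-1)/2}\frac{z^n}{[n]_q!}$. The modified second Jackson $q$-Bessel function with base $q^2$ is the entire function $$\mathcal{J}^{(2)}_\alpha(z;q^2)=\sum_{n=0}^\infty\frac{(-1)^n\,q^{2n(n+\alpha)}\,(z/2)^{2n}}{(q^2;q^2)_n(q^{2\alpha+2};q^2)_n};$$ its positive zeros are those of the second Jackson $q$-Bessel function $J^{(2)}_\alpha(\cdot;q^2)$. Put $g^{(2)}_\alpha(t;q)=\mathcal{J}^{(2)}_\alpha(t(1-q);q^2)$. The polynomials $B^{(2)}_{n,\alpha}(z;q)$ are defined by $$\frac{E_q(zt)\,E_q(-t/2)}{g^{(2)}_\alpha(it;q)}=\sum_{n=0}^\infty B^{(2)}_{n,\alpha}(z;q)\frac{t^n}{[n]_q!},\qquad |t|<\frac{j^{(2)}_{1,\alpha}}{1-q}.$$ For $\alpha=-\frac12$ the quotient $\frac{(q^{2\alpha+1};q^2)_m}{(q^{2\alpha+1};q)_m}$ with $m\ge1$ is understood after cancelling the common factor $1-q^{2\alpha+1}$, i.e. as $\frac{(q^{2\alpha+3};q^2)_{m-1}}{(q^{2\alpha+2};q)_{m-1}}$. *)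

theory Defs
  imports "HOL-Complex_Analysis.Complex_Analysis"
begin

definition qpoch :: "real \<Rightarrow> real \<Rightarrow> nat \<Rightarrow> real" where
  "qpoch a q n = (\<Prod>k<n. 1 - a * q ^ k)"

definition qint :: "real \<Rightarrow> nat \<Rightarrow> real" where
  "qint q n = (1 - q ^ n) / (1 - q)"

definition qfact :: "real \<Rightarrow> nat \<Rightarrow> real" where
  "qfact q n = (\<Prod>k=1..n. qint q k)"

text \<open>The division by 2 in the exponent \<open>n * (n - 1) div 2\<close> is always exact.\<close>

definition qPsi :: "real \<Rightarrow> nat \<Rightarrow> real" where
  "qPsi q n = q ^ (n * (n - 1) div 2) / qfact q n"

definition E_q :: "real \<Rightarrow> complex \<Rightarrow> complex" where
  "E_q q z = (\<Sum>n. of_real (q ^ (n * (n - 1) div 2)) * z ^ n / of_real (qfact q n))"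

text \<open>The modified second Jackson \<open>q\<close>-Bessel function; the base is \<open>q\<^sup>2\<close>, so that
  \<open>jackson2 \<alpha> q z\<close> is \<open>\<J>\<^sub>\<alpha>(z; q\<^sup>2)\<close>.\<close>

definition jackson2 :: "real \<Rightarrow> real \<Rightarrow> complex \<Rightarrow> complex" where
  "jackson2 \<alpha> q z =
     (\<Sum>n. (-1) ^ n * of_real (q powr (2 * real n * (real n + \<alpha>))) * (z / 2) ^ (2 * n)
         / of_real (qpoch (q\<^sup>2) (q\<^sup>2) n * qpoch (q powr (2 * \<alpha> + 2)) (q\<^sup>2) n))"

definition g2 :: "real \<Rightarrow> real \<Rightarrow> complex \<Rightarrow> complex" where
  "g2 \<alpha> q t = jackson2 \<alpha> q (t * of_real (1 - q))"

definition smallest_pos_zero :: "(complex \<Rightarrow> complex) \<Rightarrow> real \<Rightarrow> bool" where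
  "smallest_pos_zero F j \<longleftrightarrow>
     0 < j \<and> F (of_real j) = 0 \<and> (\<forall>x. 0 < x \<and> x < j \<longrightarrow> F (of_real x) \<noteq> 0)"

definition genfun2 :: "real \<Rightarrow> real \<Rightarrow> complex \<Rightarrow> complex \<Rightarrow> complex" where
  "genfun2 \<alpha> q z t = E_q q (z * t) * E_q q (- t / 2) / g2 \<alpha> q (\<i> * t)"

text \<open>The \<open>n\<close>-th coefficient of \<open>genfun2 \<alpha> q z t\<close> with respect to \<open>t ^ n / qfact q n\<close>,
  i.e. \<open>qfact q n\<close> times the \<open>n\<close>-th Taylor coefficient at \<open>t = 0\<close>.\<close>

definition B2 :: "nat \<Rightarrow> real \<Rightarrow> real \<Rightarrow> complex \<Rightarrow> complex" where
  "B2 n \<alpha> q z = of_real (qfact q n) * ((deriv ^^ n) (genfun2 \<alpha> q z) 0 / fact n)"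

text \<open>\<open>B2\<close> is the only sequence that can satisfy the generating function identity on a
  disc around 0, however small.\<close>

lemma qfact_pos: "0 < q \<Longrightarrow> q < 1 \<Longrightarrow> 0 < qfact q n"
  unfolding qfact_def qint_def
  by (intro prod_pos) (auto intro!: divide_pos_pos simp: power_less_one_iff)

lemma B2_unique:
  assumes q: "0 < q" "q < 1" and r: "0 < r"
    and b: "\<And>t. norm t < r \<Longrightarrow> (\<lambda>n. b n * t ^ n / of_real (qfact q n)) sums genfun2 \<alpha> q z t"
  shows "b n = B2 n \<alpha> q z"
proof -
  define F where "F = Abs_fps (\<lambda>n. b n / of_real (qfact q n))"
  have s: "(\<lambda>n. fps_nth F n * t ^ n) sums genfun2 \<alpha> q z t" if "norm t < r" for t
    using b[OF that] by (simp add: F_def)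
  have "genfun2 \<alpha> q z has_fps_expansion F"
  proof (rule has_fps_expansionI)
    show "eventually (\<lambda>t. (\<lambda>n. fps_nth F n * t ^ n) sums genfun2 \<alpha> q z t) (nhds 0)"
      using r s by (auto simp: eventually_nhds_metric)
  qed
  then have "fps_nth F n = (deriv ^^ n) (genfun2 \<alpha> q z) 0 / fact n"
    by (rule fps_nth_fps_expansion)
  then show ?thesis
    using qfact_pos[OF q, of n] by (simp add: B2_def F_def field_simps)
qed

text \<open>The quotient \<open>qpoch (q powr (2\<alpha>+1)) (q\<^sup>2) m / qpoch (q powr (2\<alpha>+1)) q m\<close>. For \<open>\<alpha> = -1/2\<close> and
  \<open>m \<ge> 1\<close> numerator and denominator both contain the factor \<open>1 - q powr (2\<alpha>+1) = 0\<close>, which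
  is cancelled.\<close>

definition qquot :: "real \<Rightarrow> real \<Rightarrow> nat \<Rightarrow> real" where
  "qquot \<alpha> q m =
     (if \<alpha> = -1/2 \<and> m \<ge> 1
      then qpoch (q powr (2 * \<alpha> + 3)) (q\<^sup>2) (m - 1) / qpoch (q powr (2 * \<alpha> + 2)) q (m - 1)
      else qpoch (q powr (2 * \<alpha> + 1)) (q\<^sup>2) m / qpoch (q powr (2 * \<alpha> + 1)) q m)"

text \<open>The sum over \<open>k \<ge> n\<close> is indexed by \<open>m = k - n\<close>; \<open>a\<close> is the sequence of Taylor
  coefficients of the function to be expanded.\<close>

definition L2_term :: "real \<Rightarrow> real \<Rightarrow> (nat \<Rightarrow> complex) \<Rightarrow> nat \<Rightarrow> nat \<Rightarrow> complex" where
  "L2_term \<alpha> q a n m =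
     (let k = n + m in
        a k * of_real (qpoch q q k * qquot \<alpha> q m * (1 / 2) ^ m
                       / (q ^ (k * (k - 1) div 2) * qpoch q q m)))"

definition L2 :: "real \<Rightarrow> real \<Rightarrow> (nat \<Rightarrow> complex) \<Rightarrow> nat \<Rightarrow> complex" where
  "L2 \<alpha> q a n = (\<Sum>m. L2_term \<alpha> q a n m) / of_real ((1 - q) ^ n)"

end

theory Submission
  imports Defs
begin

unbundle no vec_syntax

text \<open>Up to the scaling \<open>x = (1 - q) t / 2\<close>, a quadratic transformation of basic hypergeometric series
  factors the denominator of the generating function as \<open>E\<^sub>q(-t/2)\<close> times the series \<open>D\<close> whose
  coefficients occur in \<open>L\<^sub>n\<close>. Hence \<open>E\<^sub>q(z t)\<close> is \<open>D\<close> times the generating function,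
  which expands \<open>z\<^sup>n\<close> in the polynomials \<open>B\<^sub>k\<close>; inserting this into the power series of \<open>f\<close> and
  exchanging the summations gives the claim. The exchange needs the generating function to be
  holomorphic for \<open>|t| < j / (1 - q)\<close>, i.e. that no complex zero of the Bessel function is smaller
  in modulus than its first positive zero. This follows from a positivity argument:
  the reciprocal of the Bessel function, as a power series in the square of its argument, has
  nonnegative coefficients.\<close>

subsection \<open>Nonnegative coefficients of the reciprocal Bessel series\<close>

lemma qpoch_0 [simp]: "qpoch a q 0 = 1"
  by (simp add: qpoch_def)

lemma qpoch_Suc: "qpoch a q (Suc n) = qpoch a q n * (1 - a * q ^ n)"
  by (simp add: qpoch_def)

lemma qpoch_Suc_left: "qpoch a q (Suc n) = (1 - a) * qpoch (a * q) q n"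
  unfolding qpoch_def by (subst prod.lessThan_Suc_shift) (simp add: mult.assoc)

lemma one_minus_mult_power_pos:
  fixes a q :: real
  assumes "0 \<le> q" "q \<le> 1" "a < 1"
  shows "0 < 1 - a * q ^ n"
proof (cases "a \<le> 0")
  case True
  then have "a * q ^ n \<le> 0"
    using assms by (simp add: mult_nonpos_nonneg)
  then show ?thesis by simp
next
  case False
  then have "a * q ^ n \<le> a * 1"
    using assms by (intro mult_left_mono) (auto simp: power_le_one)
  then show ?thesis using assms by simp
qed

lemma qpoch_pos: "0 \<le> q \<Longrightarrow> q \<le> 1 \<Longrightarrow> a < 1 \<Longrightarrow> 0 < qpoch a q n"
  unfolding qpoch_def by (intro prod_pos ballI one_minus_mult_power_pos)

text \<open>With p = q^2 and b = q^(2\<alpha>) these are, up to sign, the coefficients of the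
  Jackson series in the variable y = (z/2)^2; replacing \<open>b\<close> by \<open>b * p\<close>
  raises \<alpha> by one.\<close>

definition bessel_coeff :: "real \<Rightarrow> real \<Rightarrow> nat \<Rightarrow> real" where
  "bessel_coeff b p n = p ^ n\<^sup>2 * b ^ n / (qpoch p p n * qpoch (b * p) p n)"

definition bessel_fps :: "real \<Rightarrow> real \<Rightarrow> real fps" where
  "bessel_fps b p = Abs_fps (\<lambda>n. (-1) ^ n * bessel_coeff b p n)"

lemma bessel_fps_nth_0 [simp]: "bessel_fps b p $ 0 = 1"
  by (simp add: bessel_fps_def bessel_coeff_def)

lemma bessel_coeff_Suc:
  assumes "0 < p" "p < 1" "b * p < 1"
  shows "bessel_coeff b p (Suc n) =
    p * b * (p\<^sup>2) ^ n / ((1 - p ^ Suc n) * (1 - b * p ^ Suc n)) * bessel_coeff b p n"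
  by (simp add: bessel_coeff_def qpoch_Suc power2_eq_square power_add power_mult_distrib mult_ac)

text \<open>Over a common denominator the two numerators differ by the factors \<open>1 - x\<close>
  and \<open>p ^ Suc n * (1 - b * p)\<close>, where x = b p^(n+2). Their difference
  \<open>1 - p ^ Suc n\<close> cancels the last factor of \<open>qpoch p p (Suc n)\<close>, which
  lowers the index by one.\<close>

lemma bessel_coeff_contiguous:
  assumes p: "0 < p" "p < 1" and b: "b * p < 1"
  shows "bessel_coeff b p (Suc n) - bessel_coeff (b * p) p (Suc n) =
    p * b / ((1 - b * p) * (1 - b * p\<^sup>2)) * bessel_coeff (b * p\<^sup>2) p n"
proof -
  have bp2: "1 - b * p\<^sup>2 > 0"
    using one_minus_mult_power_pos[of p "b * p" 1] p b by (simp add: power2_eq_square mult_ac)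
  have bpn: "1 - b * p ^ Suc n > 0" for n
    using one_minus_mult_power_pos[of p "b * p" n] p b by (simp add: mult_ac)
  define P where "P = qpoch (b * p\<^sup>2 * p) p n"
  define Q where "Q = qpoch p p n"
  have pos: "P > 0" "Q > 0"
    using bpn[of 2] p unfolding P_def Q_def
    by (auto intro!: qpoch_pos simp: power2_eq_square power3_eq_cube numeral_eq_Suc mult_ac)
  have Qn: "qpoch p p (Suc n) = Q * (1 - p ^ Suc n)"
    by (simp add: Q_def qpoch_Suc)
  have pn: "1 - p ^ Suc n > 0"
    using one_minus_mult_power_pos[of p p n] p by simp
  define x where "x = b * p ^ Suc (Suc n)"
  have x: "1 - x > 0" using bpn[of "Suc n"] by (simp add: x_def)
  have e: "qpoch (b * p\<^sup>2) p (Suc n) = (1 - b * p\<^sup>2) * P"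
    by (simp add: qpoch_Suc_left P_def mult_ac)
  have e2: "qpoch (b * p * p) p (Suc n) = (1 - b * p\<^sup>2) * P"
    using e by (simp add: power2_eq_square mult_ac)
  have "qpoch (b * p) p (Suc (Suc n)) = (1 - b * p) * ((1 - b * p\<^sup>2) * P)"
    using e2 by (subst qpoch_Suc_left) simp
  moreover have "qpoch (b * p) p (Suc (Suc n)) = qpoch (b * p) p (Suc n) * (1 - x)"
    by (subst qpoch_Suc) (simp add: x_def mult_ac)
  ultimately have e1: "qpoch (b * p) p (Suc n) = (1 - b * p) * ((1 - b * p\<^sup>2) * P) / (1 - x)"
    using x by (simp add: field_simps)
  have "bessel_coeff b p (Suc n) =
      p ^ (Suc n)\<^sup>2 * b ^ Suc n * (1 - x) / (Q * (1 - p ^ Suc n) * (1 - b * p) * (1 - b * p\<^sup>2) * P)"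
    unfolding bessel_coeff_def e1 Qn by (simp add: mult_ac)
  moreover have "bessel_coeff (b * p) p (Suc n) =
      p ^ (Suc n)\<^sup>2 * b ^ Suc n * (p ^ Suc n * (1 - b * p)) /
        (Q * (1 - p ^ Suc n) * (1 - b * p) * (1 - b * p\<^sup>2) * P)"
    unfolding bessel_coeff_def e2 Qn power_mult_distrib using b by simp
  ultimately have "bessel_coeff b p (Suc n) - bessel_coeff (b * p) p (Suc n) =
     p ^ (Suc n)\<^sup>2 * b ^ Suc n * (1 - x - p ^ Suc n * (1 - b * p)) /
        (Q * (1 - p ^ Suc n) * (1 - b * p) * (1 - b * p\<^sup>2) * P)"
    by (simp only: diff_divide_distrib[symmetric] right_diff_distrib[symmetric])
  also have "1 - x - p ^ Suc n * (1 - b * p) = 1 - p ^ Suc n"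
    by (simp add: x_def algebra_simps)
  also have "p ^ (Suc n)\<^sup>2 * b ^ Suc n * (1 - p ^ Suc n) /
        (Q * (1 - p ^ Suc n) * (1 - b * p) * (1 - b * p\<^sup>2) * P) =
        p ^ (Suc n)\<^sup>2 * b ^ Suc n / (Q * (1 - b * p) * (1 - b * p\<^sup>2) * P)"
    using pn by simp
  also have "p ^ (Suc n)\<^sup>2 * b ^ Suc n = p * b * (p ^ n\<^sup>2 * (b * p\<^sup>2) ^ n)"
    by (simp add: power2_eq_square power_add power_mult_distrib mult_ac)
  finally show ?thesis
    by (simp add: bessel_coeff_def P_def Q_def mult_ac)
qed

lemma bessel_fps_contiguous:
  assumes "0 < p" "p < 1" "b * p < 1"
  shows "bessel_fps b p = bessel_fps (b * p) p -
    fps_const (p * b / ((1 - b * p) * (1 - b * p\<^sup>2))) * fps_X * bessel_fps (b * p\<^sup>2) p"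
proof (rule fps_ext)
  fix n
  show "bessel_fps b p $ n = (bessel_fps (b * p) p -
    fps_const (p * b / ((1 - b * p) * (1 - b * p\<^sup>2))) * fps_X * bessel_fps (b * p\<^sup>2) p) $ n"
  proof (cases n)
    case (Suc m)
    have "bessel_coeff b p (Suc m) = bessel_coeff (b * p) p (Suc m) +
      p * b / ((1 - b * p) * (1 - b * p\<^sup>2)) * bessel_coeff (b * p\<^sup>2) p m"
      using bessel_coeff_contiguous[OF assms, of m] by simp
    then show ?thesis
      by (simp add: Suc mult.assoc bessel_fps_def algebra_simps del: times_divide_eq_left)
  qed (simp add: mult.assoc)
qed

text \<open>Contiguity turns the quotient into an S-fraction with positive coefficients.\<close>

lemma bessel_quotient_nonneg:
  assumes p: "0 < p" "p < 1" and b: "0 < b" "b * p < 1"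
  shows "0 \<le> (bessel_fps (b * p) p * inverse (bessel_fps b p)) $ n"
  using b
proof (induction n arbitrary: b rule: less_induct)
  case (less n)
  define K where "K = p * b / ((1 - b * p) * (1 - b * p\<^sup>2))"
  define R where "R b = bessel_fps (b * p) p * inverse (bessel_fps b p)" for b
  have bp: "0 < b * p" "b * p * p < 1" "b * p\<^sup>2 < 1"
    using one_minus_mult_power_pos[of p "b * p" 1] p less.prems by (auto simp: power2_eq_square mult_ac)
  have K: "0 \<le> K"
    using less.prems p bp by (simp add: K_def)
  have "bessel_fps (b * p) p =
      bessel_fps b p + fps_const K * fps_X * bessel_fps (b * p\<^sup>2) p"
    using bessel_fps_contiguous[of p b] p less.prems unfolding K_def by (simp add: algebra_simps)
  then have "R b = (bessel_fps b p + fps_const K * fps_X * bessel_fps (b * p\<^sup>2) p) *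
      inverse (bessel_fps b p)"
    by (simp add: R_def)
  also have "\<dots> = bessel_fps b p * inverse (bessel_fps b p) + fps_const K * fps_X *
      (bessel_fps (b * p\<^sup>2) p * inverse (bessel_fps (b * p) p)) *
      (bessel_fps (b * p) p * inverse (bessel_fps b p))"
  proof -
    have "bessel_fps (b * p) p * inverse (bessel_fps (b * p) p) = 1"
      by (simp add: inverse_mult_eq_1')
    then show ?thesis by algebra
  qed
  also have "\<dots> = 1 + fps_const K * fps_X * (R (b * p) * R b)"
    by (simp add: R_def inverse_mult_eq_1' power2_eq_square mult_ac)
  \<comment> \<open>Because of \<open>fps_X\<close>, coefficient n on the right involves only
    coefficients of \<open>R (b * p)\<close> and \<open>R b\<close> below n. Hence the induction on
    n with \<open>b\<close> arbitrary: \<open>b * p\<close> satisfies the same hypotheses.\<close>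
  finally have eq: "R b = 1 + fps_const K * fps_X * (R (b * p) * R b)" .
  show ?case
  proof (cases n)
    case 0
    then show ?thesis by simp
  next
    case (Suc m)
    have "R b $ n = (1 + fps_const K * fps_X * (R (b * p) * R b)) $ n"
      using eq by simp
    also have "\<dots> = K * (\<Sum>i=0..m. R (b * p) $ i * R b $ (m - i))"
      by (simp add: Suc mult.assoc) (simp add: fps_mult_nth)
    also have "\<dots> \<ge> 0"
      using less.IH[OF _ bp(1,2)] less.IH[OF _ less.prems] K Suc
      by (intro mult_nonneg_nonneg sum_nonneg) (auto simp: R_def)
    finally show ?thesis by (simp add: R_def)
  qed
qed

lemma fps_mult_nonneg:
  fixes F G :: "real fps"
  assumes "\<And>n. 0 \<le> F $ n" "\<And>n. 0 \<le> G $ n"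
  shows "0 \<le> (F * G) $ n"
  unfolding fps_mult_nth using assms by (intro sum_nonneg mult_nonneg_nonneg)

text \<open>As the order grows, the parameter tends to 0, and a coefficient of positive index
  contains a positive power of it. So the series tends to 1 coefficientwise.\<close>

lemma bessel_coeff_tendsto_0:
  assumes p: "0 < p" "p < 1"
  shows "(\<lambda>N. bessel_coeff (b * p ^ N) p (Suc n)) \<longlonglongrightarrow> 0"
proof -
  have "(\<lambda>N. b * p ^ N) \<longlonglongrightarrow> b * 0"
    using p by (intro tendsto_intros LIMSEQ_power_zero) auto
  then have lim: "(\<lambda>N. b * p ^ N) \<longlonglongrightarrow> 0" by simp
  have "(\<lambda>N. bessel_coeff (b * p ^ N) p (Suc n)) \<longlonglongrightarrow>
     p ^ (Suc n)\<^sup>2 * 0 ^ Suc n / (qpoch p p (Suc n) * (\<Prod>k<Suc n. 1 - 0 * p * p ^ k))"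
    unfolding bessel_coeff_def qpoch_def[of "_ * p"]
    using p qpoch_pos[of p p "Suc n"]
    by (intro tendsto_intros lim) auto
  then show ?thesis by simp
qed

text \<open>Telescoping: the series with parameter \<open>b * p ^ N\<close>, divided by the one with
  parameter \<open>b\<close>, is a product of N consecutive quotients with nonnegative coefficients.
  Its numerator tends to 1 coefficientwise, and the sign survives the limit.\<close>

lemma inverse_bessel_fps_nonneg:
  assumes p: "0 < p" "p < 1" and b: "0 < b" "b * p < 1"
  shows "0 \<le> inverse (bessel_fps b p) $ n"
proof -
  define I where "I = inverse (bessel_fps b p)"
  have step: "0 \<le> (bessel_fps (b * p ^ N) p * I) $ n" for N n
  proof (induction N arbitrary: n)
    case 0
    then show ?case by (simp add: I_def inverse_mult_eq_1')
  next
    case (Suc N)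
    define c where "c = b * p ^ N"
    have "c * p < 1"
      using one_minus_mult_power_pos[of p "b * p" N] p b by (simp add: c_def mult_ac)
    moreover have "0 < c" using p b by (simp add: c_def)
    ultimately have R: "0 \<le> (bessel_fps (c * p) p * inverse (bessel_fps c p)) $ k" for k
      using p by (intro bessel_quotient_nonneg)
    have "bessel_fps (c * p) p * I =
        (bessel_fps (c * p) p * inverse (bessel_fps c p)) * (bessel_fps c p * I)"
    proof -
      have "bessel_fps c p * inverse (bessel_fps c p) = 1"
        by (simp add: inverse_mult_eq_1')
      then show ?thesis by algebra
    qed
    then have "0 \<le> (bessel_fps (c * p) p * I) $ n"
      using fps_mult_nonneg[OF R Suc.IH[folded c_def]] by metis
    then show ?case by (simp add: c_def mult_ac)
  qed
  have lim: "(\<lambda>N. (bessel_fps (b * p ^ N) p) $ i) \<longlonglongrightarrow> (if i = 0 then 1 else 0)" for i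
  proof (cases i)
    case (Suc m)
    have "(\<lambda>N. (-1) ^ Suc m * bessel_coeff (b * p ^ N) p (Suc m)) \<longlonglongrightarrow> (-1) ^ Suc m * 0"
      by (intro tendsto_intros bessel_coeff_tendsto_0 p)
    then show ?thesis by (simp add: Suc bessel_fps_def)
  qed simp
  have "(\<lambda>N. (bessel_fps (b * p ^ N) p * I) $ n) \<longlonglongrightarrow>
     (\<Sum>i=0..n. (if i = 0 then 1 else 0) * I $ (n - i))"
    unfolding fps_mult_nth by (intro tendsto_intros lim)
  also have "(\<Sum>i=0..n. (if i = 0 then 1 else 0) * I $ (n - i)) = I $ n"
    by (simp add: if_distrib[of "\<lambda>x. x * _"] sum.If_cases)
  finally have "0 \<le> I $ n"
    using step by (intro LIMSEQ_le_const) auto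
  then show ?thesis by (simp add: I_def)
qed

subsection \<open>Zeros of the Bessel function\<close>

text \<open>The ratio test in recurrence form, which tolerates zero coefficients. The recurrence is
  asked for only eventually because the one for \<open>qquot\<close> can degenerate at index 0.
  \<open>L = 0\<close> serves the entire functions, \<open>L = 1\<close> the series D.\<close>

lemma summable_power_series_ratio:
  fixes c r :: "nat \<Rightarrow> real" and z :: complex
  assumes c: "eventually (\<lambda>n. c (Suc n) = r n * c n) sequentially"
    and r: "r \<longlonglongrightarrow> L" and z: "\<bar>L\<bar> * norm z < 1"
  shows "summable (\<lambda>n. norm (of_real (c n) * z ^ n))"
proof -
  have "(\<lambda>n. \<bar>r n\<bar> * norm z) \<longlonglongrightarrow> \<bar>L\<bar> * norm z"
    by (intro tendsto_intros r)
  moreover obtain k where k: "\<bar>L\<bar> * norm z < k" "k < 1"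
    using z dense by blast
  ultimately have "eventually (\<lambda>n. \<bar>r n\<bar> * norm z < k) sequentially"
    by (auto dest: order_tendstoD)
  with c have "eventually (\<lambda>n. norm (norm (of_real (c (Suc n)) * z ^ Suc n)) \<le>
      k * norm (norm (of_real (c n) * z ^ n))) sequentially"
  proof eventually_elim
    case (elim n)
    have "(\<bar>r n\<bar> * norm z) * (\<bar>c n\<bar> * norm z ^ n) \<le> k * (\<bar>c n\<bar> * norm z ^ n)"
      using elim by (intro mult_right_mono) auto
    then show ?case
      by (simp add: elim norm_mult norm_power abs_mult mult_ac)
  qed
  then obtain N where "\<And>n. n \<ge> N \<Longrightarrow> norm (norm (of_real (c (Suc n)) * z ^ Suc n)) \<le>
      k * norm (norm (of_real (c n) * z ^ n))"
    by (auto simp: eventually_sequentially)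
  then show ?thesis
    using k by (intro summable_ratio_test)
qed

section \<open>Passage from real to complex power series\<close>

definition fps_of_real :: "real fps \<Rightarrow> complex fps" where
  "fps_of_real F = Abs_fps (\<lambda>n. of_real (F $ n))"

lemma fps_of_real_nth [simp]: "fps_of_real F $ n = of_real (F $ n)"
  by (simp add: fps_of_real_def)

lemma fps_of_real_1 [simp]: "fps_of_real 1 = 1"
  by (rule fps_ext) simp

lemma fps_of_real_mult: "fps_of_real (F * G) = fps_of_real F * fps_of_real G"
  by (rule fps_ext) (simp add: fps_mult_nth)

lemma fps_of_real_inverse:
  assumes "F $ 0 \<noteq> 0"
  shows "fps_of_real (inverse F) = inverse (fps_of_real F)"
proof -
  have "fps_of_real F * fps_of_real (inverse F) = 1"
    using assms by (simp add: fps_of_real_mult[symmetric] inverse_mult_eq_1')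
  then show ?thesis by (metis fps_inverse_unique)
qed

lemma power_Suc_LIMSEQ_zero:
  fixes p :: real
  shows "0 \<le> p \<Longrightarrow> p < 1 \<Longrightarrow> (\<lambda>n. p ^ Suc n) \<longlonglongrightarrow> 0"
  by (rule LIMSEQ_Suc) (simp add: LIMSEQ_power_zero)

lemma bessel_fps_conv_radius:
  assumes p: "0 < p" "p < 1" and b: "b * p < 1"
  shows "fps_conv_radius (fps_of_real (bessel_fps b p)) = \<infinity>"
proof -
  define r where "r n = - (p * b * (p\<^sup>2) ^ n / ((1 - p ^ Suc n) * (1 - b * p ^ Suc n)))" for n
  have "r \<longlonglongrightarrow> - (p * b * 0 / ((1 - 0) * (1 - b * 0)))"
    unfolding r_def using p
    by (intro tendsto_intros power_Suc_LIMSEQ_zero LIMSEQ_power_zero) (auto simp: power_less_one_iff)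
  then have "r \<longlonglongrightarrow> 0" by simp
  moreover have "bessel_fps b p $ Suc n = r n * bessel_fps b p $ n" for n
    unfolding bessel_fps_def fps_nth_Abs_fps bessel_coeff_Suc[OF p b] r_def by simp
  ultimately have "summable (\<lambda>n. norm (of_real (bessel_fps b p $ n) * z ^ n))" for z :: complex
    by (intro summable_power_series_ratio[where r = r and L = 0]) auto
  then have "summable (\<lambda>n. fps_of_real (bessel_fps b p) $ n * z ^ n)" for z
    unfolding fps_of_real_nth by (rule summable_norm_cancel)
  then show ?thesis
    unfolding fps_conv_radius_def by (intro conv_radius_inftyI'')
qed

definition bessel_fun :: "real \<Rightarrow> real \<Rightarrow> complex \<Rightarrow> complex" where
  "bessel_fun b p = eval_fps (fps_of_real (bessel_fps b p))"

context
  fixes b p :: real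
  assumes p: "0 < p" "p < 1" and b: "0 < b" "b * p < 1"
begin

lemma bessel_fun_holomorphic: "bessel_fun b p holomorphic_on A"
  unfolding bessel_fun_def
  by (rule holomorphic_on_eval_fps) (simp add: bessel_fps_conv_radius p b)

lemma bessel_fun_expansion: "bessel_fun b p has_fps_expansion fps_of_real (bessel_fps b p)"
  unfolding bessel_fun_def
  by (rule eval_fps_has_fps_expansion) (simp add: bessel_fps_conv_radius p b)

lemma bessel_fun_0: "bessel_fun b p 0 = 1"
  by (simp add: bessel_fun_def eval_fps_at_0)

lemma bessel_fun_continuous: "continuous_on A (bessel_fun b p)"
  by (intro holomorphic_on_imp_continuous_on bessel_fun_holomorphic)

text \<open>The reciprocal has nonnegative coefficients, so on a zero-free disc its modulus is
  largest on the positive axis.\<close>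

lemma norm_bessel_fun_ge:
  assumes nz: "\<And>y. norm y < \<rho> \<Longrightarrow> bessel_fun b p y \<noteq> 0" and y: "norm y < \<rho>"
  shows "norm (bessel_fun b p (of_real (norm y))) \<le> norm (bessel_fun b p y)"
proof -
  define P where "P n = inverse (bessel_fps b p) $ n" for n
  have P: "0 \<le> P n" for n
    unfolding P_def by (rule inverse_bessel_fps_nonneg[OF p b])
  have ex: "(\<lambda>y. inverse (bessel_fun b p y)) has_fps_expansion
      fps_of_real (inverse (bessel_fps b p))"
    using has_fps_expansion_inverse[OF bessel_fun_expansion] by (simp add: fps_of_real_inverse)
  \<comment> \<open>Holomorphy on the disc makes the Taylor series of the reciprocal converge on all
    of it.\<close>
  have hol: "(\<lambda>y. inverse (bessel_fun b p y)) holomorphic_on eball 0 (ereal \<rho>)"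
    using nz by (intro holomorphic_intros bessel_fun_holomorphic) auto
  have s: "(\<lambda>n. of_real (P n) * w ^ n) sums inverse (bessel_fun b p w)" if "norm w < \<rho>" for w
    using has_fps_expansion_imp_sums_complex[OF ex hol, of w] that by (simp add: P_def)
  have s1: "(\<lambda>n. of_real (P n * norm y ^ n)) sums inverse (bessel_fun b p (of_real (norm y)))"
    using s[of "of_real (norm y)"] y by simp
  then have sm: "summable (\<lambda>n. P n * norm y ^ n)"
    using sums_summable summable_of_real_iff by blast
  have e1: "inverse (bessel_fun b p (of_real (norm y))) = of_real (\<Sum>n. P n * norm y ^ n)"
    using s1 sums_of_real[OF summable_sums[OF sm]] sums_unique2 by blast
  have nn: "norm (of_real (P n) * y ^ n) = P n * norm y ^ n" for n
    using P[of n] by (simp add: norm_mult norm_power)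
  have "inverse (bessel_fun b p y) = (\<Sum>n. of_real (P n) * y ^ n)"
    using s[OF y] by (simp add: sums_unique)
  also have "norm \<dots> \<le> (\<Sum>n. norm (of_real (P n) * y ^ n))"
    by (rule summable_norm) (simp only: nn sm)
  also have "\<dots> = (\<Sum>n. P n * norm y ^ n)"
    by (simp only: nn)
  also have "\<dots> \<le> norm (inverse (bessel_fun b p (of_real (norm y))))"
    unfolding e1 norm_of_real by simp
  finally show ?thesis
    using nz[OF y] nz[of "of_real (norm y)"] y by (simp add: norm_inverse)
qed

text \<open>As in Pringsheim's theorem: if v is a zero of least modulus, comparing the values at
  t|v| and tv as t tends to 1 forces a zero at |v|, which lies below \<open>Y\<close>.\<close>

lemma bessel_fun_zero_free:
  assumes Y: "\<And>x. 0 < x \<Longrightarrow> x < Y \<Longrightarrow> bessel_fun b p (of_real x) \<noteq> 0" and w: "norm w < Y"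
  shows "bessel_fun b p w \<noteq> 0"
proof
  assume w0: "bessel_fun b p w = 0"
  \<comment> \<open>Cutting off at the modulus of \<open>w\<close> makes the zero set compact, so a
    zero of least modulus exists.\<close>
  define Z where "Z = {y \<in> cball 0 (norm w). bessel_fun b p y = 0}"
  have "closed Z"
    unfolding Z_def
    by (intro continuous_closed_preimage_constant bessel_fun_continuous) auto
  moreover have "Z = Z \<inter> cball 0 (norm w)" by (auto simp: Z_def)
  ultimately have "compact Z"
    by (metis closed_Int_compact compact_cball)
  moreover have "w \<in> Z" using w0 by (simp add: Z_def)
  ultimately obtain v where v: "v \<in> Z" "\<And>y. y \<in> Z \<Longrightarrow> norm v \<le> norm y"
    using continuous_attains_inf[of Z norm] by (auto intro: continuous_intros)
  define \<rho> where "\<rho> = norm v"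
  have \<rho>: "\<rho> \<le> norm w" "bessel_fun b p v = 0"
    using v by (auto simp: Z_def \<rho>_def)
  have "v \<noteq> 0" using \<rho> bessel_fun_0 by auto
  then have \<rho>0: "0 < \<rho>" by (simp add: \<rho>_def)
  have nz: "bessel_fun b p y \<noteq> 0" if "norm y < \<rho>" for y
    using v(2)[of y] that \<rho>(1) by (force simp: Z_def \<rho>_def)
  \<comment> \<open>The comparison holds only inside the open zero-free disc, so \<open>v\<close> is
    approached radially from within.\<close>
  define t where "t n = 1 - 1 / real (Suc n)" for n
  have "t \<longlonglongrightarrow> 1 - 0"
    unfolding t_def by (intro tendsto_diff tendsto_const LIMSEQ_Suc[OF lim_inverse_n'])
  then have t: "t \<longlonglongrightarrow> 1" "0 \<le> t n" "t n < 1" for n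
    by (auto simp: t_def)
  have le: "norm (bessel_fun b p (of_real (t n * \<rho>))) \<le> norm (bessel_fun b p (of_real (t n) * v))" for n
  proof -
    have "norm (of_real (t n) * v) < \<rho>"
      using t(2,3)[of n] \<rho>0 by (simp add: norm_mult \<rho>_def[symmetric])
    from norm_bessel_fun_ge[OF nz this] show ?thesis
      using t(2)[of n] by (simp add: norm_mult \<rho>_def)
  qed
  have cont: "isCont (bessel_fun b p) x" for x
    using bessel_fun_continuous[of UNIV] by (simp add: continuous_on_eq_continuous_at)
  have "(\<lambda>n. norm (bessel_fun b p (of_real (t n * \<rho>)))) \<longlonglongrightarrow> norm (bessel_fun b p (of_real (1 * \<rho>)))"
    by (intro tendsto_norm isCont_tendsto_compose[OF cont] tendsto_intros t)
  moreover have "(\<lambda>n. norm (bessel_fun b p (of_real (t n) * v))) \<longlonglongrightarrow>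
      norm (bessel_fun b p (of_real 1 * v))"
    by (intro tendsto_norm isCont_tendsto_compose[OF cont] tendsto_intros t)
  ultimately have "norm (bessel_fun b p (of_real (1 * \<rho>))) \<le> norm (bessel_fun b p (of_real 1 * v))"
    by (rule LIMSEQ_le) (use le in auto)
  then have "bessel_fun b p (of_real \<rho>) = 0"
    using \<rho> by simp
  then show False
    using Y[of \<rho>] \<rho>0 \<rho>(1) w by simp
qed

end

section \<open>Translation to the Jackson function in the variable z\<close>

context
  fixes q \<alpha> :: real
  assumes q: "0 < q" "q < 1" and \<alpha>: "\<alpha> > -1"
begin

lemma bessel_params: "0 < q\<^sup>2" "q\<^sup>2 < 1" "0 < q powr (2 * \<alpha>)" "q powr (2 * \<alpha>) * q\<^sup>2 < 1"
proof -
  have "q powr (2 * \<alpha>) * q\<^sup>2 = q powr (2 * \<alpha> + 2)"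
    using q by (simp add: powr_add powr_realpow)
  also have "\<dots> < 1"
    using q \<alpha> powr_less_mono'[of q 0 "2 * \<alpha> + 2"] by simp
  finally show "q powr (2 * \<alpha>) * q\<^sup>2 < 1" .
qed (use q in \<open>auto simp: power_less_one_iff\<close>)

lemma jackson2_conv_bessel_fun: "jackson2 \<alpha> q z = bessel_fun (q powr (2 * \<alpha>)) (q\<^sup>2) ((z / 2)\<^sup>2)"
proof -
  have "q powr (2 * real n * (real n + \<alpha>)) = (q\<^sup>2) ^ n\<^sup>2 * (q powr (2 * \<alpha>)) ^ n" for n
  proof -
    have "q powr (2 * real n * (real n + \<alpha>)) = q powr (real (2 * n\<^sup>2) + 2 * \<alpha> * real n)"
      by (simp add: algebra_simps power2_eq_square)
    also have "\<dots> = q ^ (2 * n\<^sup>2) * (q powr (2 * \<alpha>)) powr real n"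
      using q by (simp only: powr_add powr_realpow powr_powr)
    also have "\<dots> = (q\<^sup>2) ^ n\<^sup>2 * (q powr (2 * \<alpha>)) ^ n"
      using q by (simp add: powr_realpow power_mult)
    finally show ?thesis .
  qed
  moreover have "q powr (2 * \<alpha> + 2) = q powr (2 * \<alpha>) * q\<^sup>2"
    using q by (simp add: powr_add powr_realpow)
  ultimately show ?thesis
    unfolding jackson2_def bessel_fun_def eval_fps_def
    by (intro suminf_cong) (simp add: bessel_fps_def bessel_coeff_def power_mult)
qed

text \<open>Under y = (z/2)^2 a positive x comes from z = 2 sqrt x, so the positive axis below
  (j/2)^2 is free of zeros in y, and the zero-free disc pulls back to |z| < j.\<close>

lemma jackson2_zero_free:
  assumes j: "smallest_pos_zero (jackson2 \<alpha> q) j" and z: "norm z < j"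
  shows "jackson2 \<alpha> q z \<noteq> 0"
proof -
  have "norm ((z / 2)\<^sup>2) < (j / 2)\<^sup>2"
    using z by (simp add: norm_power norm_divide power_strict_mono power_divide)
  moreover have "bessel_fun (q powr (2 * \<alpha>)) (q\<^sup>2) (of_real x) \<noteq> 0"
    if x: "0 < x" "x < (j / 2)\<^sup>2" for x
  proof -
    have "0 < j" using j by (simp add: smallest_pos_zero_def)
    then have "sqrt x < j / 2"
      using x by (intro real_less_lsqrt) auto
    then have "jackson2 \<alpha> q (of_real (2 * sqrt x)) \<noteq> 0"
      using j x by (auto simp: smallest_pos_zero_def simp del: of_real_mult)
    moreover have "(of_real (2 * sqrt x) / 2 :: complex)\<^sup>2 = of_real x"
      using x by (simp flip: of_real_power)
    ultimately show ?thesis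
      unfolding jackson2_conv_bessel_fun by metis
  qed
  ultimately show ?thesis
    using bessel_fun_zero_free[OF bessel_params] unfolding jackson2_conv_bessel_fun by blast
qed

end

subsection \<open>The quadratic transformation\<close>

text \<open>The substitution of sX for X. With s = q it is the shift in the q-difference equations,
  with s = (1-q)/2 the passage from x to t.\<close>

definition qscale :: "'a :: comm_semiring_1 \<Rightarrow> 'a fps \<Rightarrow> 'a fps" where
  "qscale s F = Abs_fps (\<lambda>n. s ^ n * F $ n)"

lemma qscale_nth [simp]: "qscale s F $ n = s ^ n * F $ n"
  by (simp add: qscale_def)

lemma qscale_mult: "qscale s (F * G) = qscale s F * qscale s G"
proof (rule fps_ext)
  fix n
  have "s ^ n * (F $ i * G $ (n - i)) = s ^ i * F $ i * (s ^ (n - i) * G $ (n - i))"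
    if "i \<le> n" for i
  proof -
    have "s ^ n = s ^ i * s ^ (n - i)" using that by (simp flip: power_add)
    then show ?thesis by (simp add: mult_ac)
  qed
  then show "qscale s (F * G) $ n = (qscale s F * qscale s G) $ n"
    by (simp add: fps_mult_nth sum_distrib_left)
qed

lemma triangle_Suc: "Suc n * (Suc n - 1) div 2 = n * (n - 1) div 2 + n"
proof -
  have "Suc n * (Suc n - 1) = n * (n - 1) + n * 2" by (cases n) auto
  then show ?thesis by simp
qed

text \<open>Euler's series for the infinite product of the factors 1 - x q^k; at x = (1-q)t/2 it is
  E_q(-t/2).\<close>

definition qexp_fps :: "real \<Rightarrow> real fps" where
  "qexp_fps q = Abs_fps (\<lambda>n. (-1) ^ n * q ^ (n * (n - 1) div 2) / qpoch q q n)"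

text \<open>The series D, that is 2phi1(a, -a; a^2; q, x) with a^2 = q^(2\<alpha>+1), read after
  cancellation when \<alpha> = -1/2.\<close>

definition qquot_fps :: "real \<Rightarrow> real \<Rightarrow> real fps" where
  "qquot_fps \<alpha> q = Abs_fps (\<lambda>n. qquot \<alpha> q n / qpoch q q n)"

text \<open>The Jackson series at z = 2ix, where y = -x^2 removes the alternating signs.\<close>

definition bessel2_fps :: "real \<Rightarrow> real \<Rightarrow> real fps" where
  "bessel2_fps \<alpha> q =
    Abs_fps (\<lambda>n. if even n then bessel_coeff (q powr (2 * \<alpha>)) (q\<^sup>2) (n div 2) else 0)"

context
  fixes q \<alpha> :: real
  assumes q: "0 < q" "q < 1" and \<alpha>: "\<alpha> > -1"
begin

lemma qpoch_q_pos: "0 < qpoch q q n"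
  using q by (intro qpoch_pos) auto

lemma qquot_0 [simp]: "qquot \<alpha> q 0 = 1"
  by (simp add: qquot_def)

lemma qquot_1: "qquot \<alpha> q (Suc 0) = 1"
proof (cases "\<alpha> = -1/2")
  case False
  then have "q powr (2 * \<alpha> + 1) \<noteq> 1"
    using q by (simp add: powr_eq_one_iff_gen)
  then show ?thesis using False by (simp add: qquot_def qpoch_Suc)
qed (simp add: qquot_def)

text \<open>From \<alpha> > -1 the exponent 2\<alpha> + n is certain to be positive only for n \<ge>
  2; at n = 1 the factor can vanish or be negative.\<close>

lemma qquot_denom_pos:
  assumes "n \<ge> 2"
  shows "0 < 1 - q powr (2 * \<alpha>) * q ^ n"
proof -
  obtain k where "n = 2 + k" using assms le_Suc_ex by blast
  then show ?thesis
    using one_minus_mult_power_pos[of q "q powr (2 * \<alpha>) * q\<^sup>2" k] bessel_params[OF q \<alpha>] q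
    by (simp only: power_add mult.assoc)
qed

text \<open>Stated without division: at m = 0 the two factors coincide, and vanish if \<alpha> =
  -1/2, while for m \<ge> 1 the left factor is positive.\<close>

lemma qquot_Suc:
  "qquot \<alpha> q (Suc m) * (1 - q powr (2 * \<alpha>) * q ^ Suc m) =
   qquot \<alpha> q m * (1 - q powr (2 * \<alpha>) * q ^ Suc (2 * m))"
proof (cases m)
  case 0
  then show ?thesis using qquot_1 by simp
next
  case (Suc k)
  have pos: "0 < 1 - q powr (2 * \<alpha>) * q ^ Suc m"
    using Suc by (intro qquot_denom_pos) simp
  show ?thesis
  proof (cases "\<alpha> = -1/2")
    case True
    have inv: "q powr (2 * \<alpha>) * q ^ Suc i = q ^ i" for i
      using True q by (simp add: powr_minus)
    have qk: "1 - q * q ^ k > 0"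
      using one_minus_mult_power_pos[of q q k] q by simp
    have "qquot \<alpha> q (Suc m) = qpoch (q\<^sup>2) (q\<^sup>2) (Suc k) / qpoch q q (Suc k)"
      "qquot \<alpha> q m = qpoch (q\<^sup>2) (q\<^sup>2) k / qpoch q q k"
      using True Suc q by (simp_all add: qquot_def)
    then show ?thesis
      unfolding inv using qk qpoch_q_pos[of k]
      by (simp add: Suc qpoch_Suc power2_eq_square power_mult_distrib power_mult mult_ac)
  next
    case False
    define \<beta> where "\<beta> = q powr (2 * \<alpha> + 1)"
    have \<beta>: "\<beta> = q powr (2 * \<alpha>) * q" "\<beta> \<noteq> 1"
    proof -
      show "\<beta> = q powr (2 * \<alpha>) * q"
        using q by (simp add: \<beta>_def powr_add)
      show "\<beta> \<noteq> 1"
        using q False by (simp add: \<beta>_def powr_eq_one_iff_gen)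
    qed
    have "qpoch \<beta> q m \<noteq> 0"
    proof -
      have "1 - \<beta> * q ^ i \<noteq> 0" for i
        using \<beta> qquot_denom_pos[of "Suc i"] by (cases i) (auto simp: mult_ac)
      then show ?thesis by (simp add: qpoch_def)
    qed
    then show ?thesis
      using False pos unfolding qquot_def \<beta>_def[symmetric]
      by (simp add: qpoch_Suc \<beta>(1) power_mult power_mult_distrib power2_eq_square mult_ac)
  qed
qed

text \<open>The coefficient form of splitting the factor 1 - x off the infinite product.\<close>

lemma qexp_fps_qdiff: "qexp_fps q = (1 - fps_X) * qscale q (qexp_fps q)"
proof (rule fps_ext)
  fix n
  show "qexp_fps q $ n = ((1 - fps_X) * qscale q (qexp_fps q)) $ n"
  proof (cases n)
    case (Suc m)
    have "1 - q * q ^ m > 0"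
      using one_minus_mult_power_pos[of q q m] q by simp
    then show ?thesis
      using qpoch_q_pos[of m] unfolding Suc left_diff_distrib qexp_fps_def
      by (simp add: triangle_Suc[simplified] qpoch_Suc power_add field_simps)
  qed (simp add: left_diff_distrib qexp_fps_def)
qed

text \<open>Multiplying coefficient n by q^n is \<open>qscale q\<close>. In the recurrence from
  \<open>qquot_Suc\<close>, expanding (1-Q)(1-bQ) with Q = q^(m+1) gives the unshifted, once shifted
  and twice shifted series; the factor 1 - b q^(2m+1) supplies the terms with
  \<open>fps_X\<close>.\<close>

lemma qquot_fps_qdiff:
  defines "b \<equiv> q powr (2 * \<alpha>)"
  shows "(1 - fps_X) * qquot_fps \<alpha> q - fps_const (1 + b) * qscale q (qquot_fps \<alpha> q) +
    fps_const b * (1 + fps_const q * fps_X) * qscale q (qscale q (qquot_fps \<alpha> q)) = 0"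
    (is "?L = 0")
proof (rule fps_ext)
  fix n
  show "?L $ n = 0 $ n"
  proof (cases n)
    case (Suc m)
    define d where "d n = qquot \<alpha> q n / qpoch q q n" for n
    have "1 - q * q ^ m > 0"
      using one_minus_mult_power_pos[of q q m] q by simp
    then have "d (Suc m) * (1 - q * q ^ m) = qquot \<alpha> q (Suc m) / qpoch q q m"
      using qpoch_q_pos[of m] by (simp add: d_def qpoch_Suc)
    then have rec: "d (Suc m) * (1 - q * q ^ m) * (1 - b * q ^ Suc m) = d m * (1 - b * q ^ Suc (2 * m))"
      using qquot_Suc[of m] by (simp add: b_def d_def)
    have "?L $ n = d (Suc m) - d m - (1 + b) * (q ^ Suc m * d (Suc m)) +
        b * (q ^ Suc m * (q ^ Suc m * d (Suc m)) + q * (q ^ m * (q ^ m * d m)))"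
      unfolding Suc by (simp add: qquot_fps_def d_def algebra_simps)
    also have "\<dots> = d (Suc m) * (1 - q * q ^ m) * (1 - b * q ^ Suc m) - d m * (1 - b * q ^ Suc (2 * m))"
      by (simp add: algebra_simps power_add power_mult power2_eq_square)
    finally show ?thesis using rec by simp
  qed (simp add: left_diff_distrib qquot_fps_def algebra_simps)
qed

text \<open>A quadratic transformation of a basic hypergeometric series: both sides satisfy the same
  second-order \<open>q\<close>-difference equation, which determines the coefficients up to the first two.\<close>

lemma qexp_fps_mult_qquot_fps: "qexp_fps q * qquot_fps \<alpha> q = bessel2_fps \<alpha> q"
proof -
  define b where "b = q powr (2 * \<alpha>)"
  define W where "W = qexp_fps q * qquot_fps \<alpha> q"
  have "qscale q (1 - fps_X) = 1 - fps_const q * fps_X"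
    by (rule fps_ext) (simp add: fps_X_def)
  then have E2: "qscale q (qexp_fps q) = (1 - fps_const q * fps_X) * qscale q (qscale q (qexp_fps q))"
    using arg_cong[OF qexp_fps_qdiff, of "qscale q"] by (simp only: qscale_mult)
  have c: "fps_const (q\<^sup>2) = fps_const q * fps_const q"
    by (simp add: power2_eq_square)
  \<comment> \<open>Multiply the equation of D by (1 - qx) times the twice shifted q-exponential.
    The product (1 - qx)(1 + qx) leaves only x^2, so even and odd coefficients decouple.\<close>
  have "W - fps_const (1 + b) * qscale q W +
      fps_const b * (1 - fps_const (q\<^sup>2) * fps_X\<^sup>2) * qscale q (qscale q W) = 0"
    using qquot_fps_qdiff[folded b_def] qexp_fps_qdiff E2
    unfolding W_def qscale_mult c by algebra
  then have rec: "(W - fps_const (1 + b) * qscale q W +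
      fps_const b * (1 - fps_const (q\<^sup>2) * fps_X\<^sup>2) * qscale q (qscale q W)) $ n = 0" for n
    by simp
  have step: "(1 - q ^ (n + 2)) * (1 - b * q ^ (n + 2)) * W $ (n + 2) = b * q ^ (2 * n + 2) * W $ n" for n
  proof -
    have "(W - fps_const (1 + b) * qscale q W +
      fps_const b * (1 - fps_const (q\<^sup>2) * fps_X\<^sup>2) * qscale q (qscale q W)) $ (n + 2) =
      W $ (n + 2) - (1 + b) * (q ^ (n + 2) * W $ (n + 2)) +
      b * (q ^ (n + 2) * (q ^ (n + 2) * W $ (n + 2)) - q\<^sup>2 * (q ^ n * (q ^ n * W $ n)))"
      by (simp add: left_diff_distrib mult.assoc fps_X_power_mult_nth)
    then show ?thesis
      using rec[of "n + 2"] by (simp add: algebra_simps power_add power_mult power2_eq_square)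
  qed
  have W0: "W $ 0 = 1"
    by (simp add: W_def qexp_fps_def qquot_fps_def)
  \<comment> \<open>The linear coefficients -1/(1-q) and 1/(1-q) cancel, also for \<alpha> = -1/2
    thanks to \<open>qquot_1\<close>.\<close>
  have W1: "W $ Suc 0 = 0"
    using q by (simp add: W_def fps_mult_nth qexp_fps_def qquot_fps_def qquot_1 qpoch_Suc)
  have nz: "1 - q ^ (n + 2) \<noteq> 0" "1 - b * q ^ (n + 2) \<noteq> 0" for n
    using qquot_denom_pos[of "n + 2"] one_minus_mult_power_pos[of q q "Suc n"] q
    by (auto simp: b_def)
  have odd: "W $ Suc (2 * k) = 0" for k
  proof (induction k)
    case (Suc k)
    then show ?case using step[of "Suc (2 * k)"] nz[of "Suc (2 * k)"] by simp
  qed (simp add: W1)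
  have even: "W $ (2 * k) = bessel_coeff b (q\<^sup>2) k" for k
  proof (induction k)
    case 0
    then show ?case by (simp add: W0 bessel_coeff_def)
  next
    case (Suc k)
    have "q ^ (2 * k + 2) = (q\<^sup>2) ^ Suc k" "q ^ (2 * (2 * k) + 2) = q\<^sup>2 * ((q\<^sup>2)\<^sup>2) ^ k"
      by (simp_all only: power_mult[symmetric] power_add[symmetric]) (simp_all add: algebra_simps)
    note e = this
    have i: "2 * Suc k = 2 * k + 2" by simp
    have solve: "w = u * b * z / (A * B) * c"
      if "A * B * w = b * (u * z) * c" "A \<noteq> 0" "B \<noteq> 0" for A B b c u w z :: real
      using that by (simp add: field_simps)
    define A where "A = 1 - (q\<^sup>2) ^ Suc k"
    define B where "B = 1 - b * (q\<^sup>2) ^ Suc k"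
    have "A * B * W $ (2 * Suc k) = b * (q\<^sup>2 * ((q\<^sup>2)\<^sup>2) ^ k) * bessel_coeff b (q\<^sup>2) k"
      using step[of "2 * k"] unfolding e Suc.IH A_def B_def i .
    moreover have "A \<noteq> 0" "B \<noteq> 0"
      using nz[of "2 * k"] unfolding e A_def B_def by auto
    moreover have "bessel_coeff b (q\<^sup>2) (Suc k) =
        q\<^sup>2 * b * ((q\<^sup>2)\<^sup>2) ^ k / (A * B) * bessel_coeff b (q\<^sup>2) k"
      using bessel_coeff_Suc[OF bessel_params(1,2,4)[OF q \<alpha>], of k]
      unfolding A_def B_def b_def .
    ultimately show ?case
      using solve by metis
  qed
  have "W $ n = bessel2_fps \<alpha> q $ n" for n
    using even[of "n div 2"] odd[of "n div 2"]
    by (cases "even n") (auto simp: bessel2_fps_def b_def)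
  then show ?thesis
    by (intro fps_ext) (simp add: W_def)
qed

end

subsection \<open>Rearranging the double series\<close>

text \<open>The geometric bound on \<open>c\<close> splits along n = k + m, so the family over all
  pairs (k, m) has a summable product majorant. Summing it by rows gives the claim; summing along n
  = k + m gives the known value \<open>s\<close>.\<close>

lemma summable_Cauchy_rearrange:
  fixes c \<delta> \<beta> :: "nat \<Rightarrow> complex"
  assumes c: "\<And>n. norm (c n) \<le> C * \<rho> ^ n"
    and \<rho>: "0 \<le> \<rho>"
    and \<delta>: "summable (\<lambda>m. norm (\<delta> m) * \<rho> ^ m)"
    and \<beta>: "summable (\<lambda>k. norm (\<beta> k) * \<rho> ^ k)"
    and s: "(\<lambda>n. c n * (\<Sum>k=0..n. \<beta> k * \<delta> (n - k))) sums s"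
  shows "summable (\<lambda>m. c (k + m) * \<delta> m)" (is ?A)
    and "(\<lambda>k. (\<Sum>m. c (k + m) * \<delta> m) * \<beta> k) sums s" (is ?B)
proof -
  have bound: "norm (c (k + m) * \<delta> m * \<beta> k) \<le> C * ((norm (\<beta> k) * \<rho> ^ k) * (norm (\<delta> m) * \<rho> ^ m))" for k m
  proof -
    have "norm (c (k + m)) * (norm (\<delta> m) * norm (\<beta> k)) \<le>
        C * \<rho> ^ (k + m) * (norm (\<delta> m) * norm (\<beta> k))"
      by (intro mult_right_mono c) auto
    then show ?thesis by (simp add: norm_mult power_add mult_ac)
  qed
  \<comment> \<open>Row convergence is shown without the factor \<open>\<beta> k\<close>, which may
    be zero.\<close>
  have inner: "summable (\<lambda>m. norm (c (k + m) * \<delta> m))" for k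
  proof (rule summable_comparison_test')
    show "summable (\<lambda>m. C * \<rho> ^ k * (norm (\<delta> m) * \<rho> ^ m))"
      by (intro summable_mult \<delta>)
    show "norm (norm (c (k + m) * \<delta> m)) \<le> C * \<rho> ^ k * (norm (\<delta> m) * \<rho> ^ m)" if "m \<ge> 0" for m
    proof -
      have "norm (c (k + m)) * norm (\<delta> m) \<le> C * \<rho> ^ (k + m) * norm (\<delta> m)"
        by (intro mult_right_mono c) auto
      then show ?thesis by (simp add: norm_mult power_add mult_ac)
    qed
  qed
  then show ?A by (rule summable_norm_cancel)
  define F where "F = (\<lambda>(k, m). c (k + m) * \<delta> m * \<beta> k)"
  have \<delta>': "(\<lambda>m. norm (\<delta> m) * \<rho> ^ m) summable_on UNIV"
    and \<beta>': "(\<lambda>k. norm (\<beta> k) * \<rho> ^ k) summable_on UNIV"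
    using \<delta> \<beta> \<rho> by (auto intro!: summable_nonneg_imp_summable_on)
  have "(\<lambda>(k, m). (norm (\<beta> k) * \<rho> ^ k) * (norm (\<delta> m) * \<rho> ^ m)) summable_on UNIV \<times> UNIV"
  proof (rule summable_on_SigmaI)
    fix k :: nat
    show "((\<lambda>m. case (k, m) of (k, m) \<Rightarrow> (norm (\<beta> k) * \<rho> ^ k) * (norm (\<delta> m) * \<rho> ^ m)) has_sum
        (norm (\<beta> k) * \<rho> ^ k) * (\<Sum>\<^sub>\<infinity>m. norm (\<delta> m) * \<rho> ^ m)) UNIV"
      using \<delta>' by (simp add: has_sum_cmult_right)
  qed (use \<beta>' \<rho> in \<open>auto intro!: summable_on_cmult_left\<close>)
  then have "(\<lambda>x. C * (case x of (k, m) \<Rightarrow> (norm (\<beta> k) * \<rho> ^ k) * (norm (\<delta> m) * \<rho> ^ m)))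
      summable_on UNIV \<times> UNIV"
    by (rule summable_on_cmult_right)
  then have "(\<lambda>x. norm (F x)) summable_on UNIV \<times> UNIV"
    by (rule Infinite_Sum.abs_summable_on_comparison_test') (use bound in \<open>auto simp: F_def\<close>)
  then have "F summable_on UNIV \<times> UNIV"
    by (rule Infinite_Sum.abs_summable_summable)
  then obtain S where S: "(F has_sum S) (UNIV \<times> UNIV)"
    unfolding summable_on_def by (elim exE)
  have "((\<lambda>k. (\<Sum>m. c (k + m) * \<delta> m) * \<beta> k) has_sum S) UNIV"
  proof (rule has_sum_SigmaD[OF S])
    fix k :: nat
    have "((\<lambda>m. c (k + m) * \<delta> m) has_sum (\<Sum>m. c (k + m) * \<delta> m)) UNIV"
      by (rule norm_summable_imp_has_sum[OF inner summable_sums[OF summable_norm_cancel[OF inner]]])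
    then show "((\<lambda>m. F (k, m)) has_sum (\<Sum>m. c (k + m) * \<delta> m) * \<beta> k) UNIV"
      by (simp add: F_def has_sum_cmult_left)
  qed
  moreover have "((\<lambda>(n, k). F (k, n - k)) has_sum S) (SIGMA n:UNIV. {0..n})"
    by (subst has_sum_reindex_bij_witness[of _ "\<lambda>(k, m). (k + m, k)" "\<lambda>(n, k). (k, n - k)"
          "UNIV \<times> UNIV" F]) (use S in auto)
  then have "((\<lambda>n. \<Sum>k=0..n. F (k, n - k)) has_sum S) UNIV"
    by (rule has_sum_SigmaD) (simp add: has_sum_finite)
  then have "((\<lambda>n. c n * (\<Sum>k=0..n. \<beta> k * \<delta> (n - k))) has_sum S) UNIV"
    by (simp add: F_def sum_distrib_left mult_ac)
  then have "S = s"
    by (intro sums_unique2[OF has_sum_imp_sums s])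
  ultimately show ?B
    by (simp add: has_sum_imp_sums)
qed

text \<open>A limit below \<rho> bounds all but finitely many terms by \<rho>^n; the exceptions are
  absorbed into \<open>C\<close>.\<close>

lemma root_tendsto_imp_power_bound:
  fixes c :: "nat \<Rightarrow> 'a :: real_normed_vector"
  assumes lim: "(\<lambda>n. root n (norm (c n))) \<longlonglongrightarrow> \<tau>" and \<rho>: "\<tau> < \<rho>" "0 < \<rho>"
  obtains C where "\<And>n. norm (c n) \<le> C * \<rho> ^ n"
proof -
  have "eventually (\<lambda>n. root n (norm (c n)) < \<rho>) sequentially"
    using lim \<rho> by (intro order_tendstoD)
  \<comment> \<open>Index 0 is left out since \<open>root 0\<close> is constantly 0 and does not
    invert the power.\<close>
  then have "eventually (\<lambda>n. norm (norm (c n) / \<rho> ^ n) \<le> 1) sequentially"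
    using eventually_gt_at_top[of 0]
  proof eventually_elim
    case (elim n)
    have "norm (c n) = root n (norm (c n)) ^ n"
      using elim by simp
    also have "\<dots> \<le> \<rho> ^ n"
      using elim by (intro power_mono) auto
    finally show ?case using \<rho> by simp
  qed
  then have "Bseq (\<lambda>n. norm (c n) / \<rho> ^ n)"
    by (rule BfunI)
  then obtain C where "\<And>n. norm (norm (c n) / \<rho> ^ n) \<le> C"
    by (auto simp: Bseq_def)
  then have "norm (c n) \<le> C * \<rho> ^ n" for n
    using \<rho> by (simp add: divide_le_eq)
  then show ?thesis using that by blast
qed

subsection \<open>The generating function\<close>

lemma entire_sums_imp_holomorphic:
  fixes h :: "complex \<Rightarrow> complex"
  assumes "\<And>z. (\<lambda>n. c n * z ^ n) sums h z"
  shows "h holomorphic_on A"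
proof -
  have "fps_conv_radius (Abs_fps c) = \<infinity>"
    unfolding fps_conv_radius_def using assms
    by (intro conv_radius_inftyI'') (auto simp: sums_iff)
  then have "eval_fps (Abs_fps c) holomorphic_on A"
    by (intro holomorphic_on_eval_fps) simp
  moreover have "h = eval_fps (Abs_fps c)"
    using assms by (auto simp: eval_fps_def sums_iff)
  ultimately show ?thesis by simp
qed

section \<open>Power series of the q-exponential\<close>

context
  fixes q :: real
  assumes q: "0 < q" "q < 1"
begin

lemma qpoch_conv_qfact: "qpoch q q n = (1 - q) ^ n * qfact q n"
  using q by (induction n) (simp_all add: qpoch_Suc qfact_def qint_def)

lemma qPsi_conv_qpoch: "qPsi q n = q ^ (n * (n - 1) div 2) * (1 - q) ^ n / qpoch q q n"
  using q by (simp add: qPsi_def qpoch_conv_qfact)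

lemma qPsi_pos: "0 < qPsi q n"
  using q qfact_pos[OF q, of n] by (simp add: qPsi_def)

lemma E_q_sums: "(\<lambda>n. of_real (qPsi q n) * z ^ n) sums E_q q z"
proof -
  define r where "r n = q ^ n * (1 - q) / (1 - q ^ Suc n)" for n
  have "r \<longlonglongrightarrow> 0 * (1 - q) / (1 - 0)"
    unfolding r_def using q
    by (intro tendsto_intros power_Suc_LIMSEQ_zero LIMSEQ_power_zero) auto
  moreover have "qPsi q (Suc n) = r n * qPsi q n" for n
    by (simp add: qPsi_conv_qpoch qpoch_Suc triangle_Suc[simplified] r_def power_add mult_ac)
  ultimately have "summable (\<lambda>n. norm (of_real (qPsi q n) * z ^ n))"
    by (intro summable_power_series_ratio[where r = r and L = 0]) auto
  then have "summable (\<lambda>n. of_real (qPsi q n) * z ^ n)"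
    by (rule summable_norm_cancel)
  then have "(\<lambda>n. of_real (qPsi q n) * z ^ n) sums (\<Sum>n. of_real (qPsi q n) * z ^ n)"
    by (rule summable_sums)
  also have "(\<Sum>n. of_real (qPsi q n) * z ^ n) = E_q q z"
    by (simp add: E_q_def qPsi_def)
  finally show ?thesis .
qed

lemma E_q_mult_expansion:
  "(\<lambda>t. E_q q (z * t)) has_fps_expansion Abs_fps (\<lambda>n. of_real (qPsi q n) * z ^ n)"
  using E_q_sums[of "z * _"]
  by (intro has_fps_expansionI always_eventually) (simp add: power_mult_distrib mult_ac)

lemma E_q_neg_half_expansion:
  "(\<lambda>t. E_q q (- t / 2)) has_fps_expansion fps_of_real (qscale ((1 - q) / 2) (qexp_fps q))"
proof -
  have "of_real (qPsi q n) * (- 1 / 2) ^ n = fps_of_real (qscale ((1 - q) / 2) (qexp_fps q)) $ n" for n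
    by (subst power_divide) (simp add: qPsi_conv_qpoch qexp_fps_def power_divide mult_ac)
  then have "Abs_fps (\<lambda>n. of_real (qPsi q n) * (- 1 / 2) ^ n) =
      fps_of_real (qscale ((1 - q) / 2) (qexp_fps q))"
    by (intro fps_ext) simp
  then show ?thesis
    using E_q_mult_expansion[of "- 1 / 2"] by simp
qed

lemma E_q_holomorphic: "E_q q holomorphic_on A"
  by (rule entire_sums_imp_holomorphic[OF E_q_sums])

end

section \<open>Taylor series of the generating function and the terms of L_n\<close>

context
  fixes q \<alpha> :: real
  assumes q: "0 < q" "q < 1" and \<alpha>: "\<alpha> > -1"
begin

lemma g2_sums:
  "(\<lambda>n. fps_of_real (qscale ((1 - q) / 2) (bessel2_fps \<alpha> q)) $ n * t ^ n) sums g2 \<alpha> q (\<i> * t)"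
proof -
  define b where "b = q powr (2 * \<alpha>)"
  define s where "s = (1 - q) / 2"
  define y where "y = (\<i> * t * of_real (1 - q) / 2)\<^sup>2"
  \<comment> \<open>The factor i makes y the negative of a square; the resulting (-1)^k cancels the
    sign in \<open>bessel_fps\<close>.\<close>
  have y: "y = - ((of_real s * t)\<^sup>2)"
    by (simp add: y_def s_def power_mult_distrib power_divide mult_ac)
  have params: "0 < q\<^sup>2" "q\<^sup>2 < 1" "b * q\<^sup>2 < 1"
    using bessel_params[OF q \<alpha>] by (simp_all add: b_def)
  define F where "F = fps_of_real (qscale s (bessel2_fps \<alpha> q))"
  have "(\<lambda>k. fps_of_real (bessel_fps b (q\<^sup>2)) $ k * y ^ k) sums bessel_fun b (q\<^sup>2) y"
    unfolding bessel_fun_def by (rule sums_eval_fps) (simp add: bessel_fps_conv_radius[OF params])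
  also have "(\<lambda>k. fps_of_real (bessel_fps b (q\<^sup>2)) $ k * y ^ k) = (\<lambda>k. F $ (2 * k) * t ^ (2 * k))"
  proof
    fix k
    have "y ^ k = (-1) ^ k * (of_real s ^ (2 * k) * t ^ (2 * k))"
      unfolding y by (subst power_minus) (simp add: power_mult_distrib flip: power_mult)
    moreover have "(-1 :: complex) ^ k * (-1) ^ k = 1"
      by (simp flip: power_mult_distrib)
    ultimately show "fps_of_real (bessel_fps b (q\<^sup>2)) $ k * y ^ k = F $ (2 * k) * t ^ (2 * k)"
      by (simp add: F_def bessel2_fps_def bessel_fps_def b_def[symmetric])
  qed
  finally have "(\<lambda>k. F $ (2 * k) * t ^ (2 * k)) sums bessel_fun b (q\<^sup>2) y" .
  \<comment> \<open>Odd coefficients vanish, so the series in y is the full power series in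
    t.\<close>
  moreover have "(\<lambda>k. F $ (2 * k) * t ^ (2 * k)) sums bessel_fun b (q\<^sup>2) y \<longleftrightarrow>
      (\<lambda>n. F $ n * t ^ n) sums bessel_fun b (q\<^sup>2) y"
  proof (rule sums_mono_reindex[of "\<lambda>k. 2 * k"])
    show "F $ n * t ^ n = 0" if "n \<notin> range (\<lambda>k. 2 * k)" for n
      using that by (auto simp: F_def bessel2_fps_def elim!: evenE)
  qed (simp add: strict_mono_def)
  ultimately show ?thesis
    by (simp add: F_def s_def y_def b_def g2_def jackson2_conv_bessel_fun[OF q \<alpha>])
qed

lemma g2_expansion: "(\<lambda>t. g2 \<alpha> q (\<i> * t)) has_fps_expansion
    fps_of_real (qscale ((1 - q) / 2) (bessel2_fps \<alpha> q))"
  by (intro has_fps_expansionI always_eventually) (simp only: g2_sums simp_thms)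

lemma g2_holomorphic: "(\<lambda>t. g2 \<alpha> q (\<i> * t)) holomorphic_on A"
  by (rule entire_sums_imp_holomorphic[OF g2_sums])

lemma bessel2_fps_nth_0: "bessel2_fps \<alpha> q $ 0 = 1"
  by (simp add: bessel2_fps_def bessel_coeff_def)

text \<open>Coefficients with respect to t^n, hence without the factor [n]_q! carried by
  \<open>B2\<close>.\<close>

definition B2_fps :: "complex \<Rightarrow> complex fps" where
  "B2_fps z = Abs_fps (\<lambda>n. of_real (qPsi q n) * z ^ n) *
     fps_of_real (qscale ((1 - q) / 2) (qexp_fps q)) /
     fps_of_real (qscale ((1 - q) / 2) (bessel2_fps \<alpha> q))"

lemma genfun2_expansion: "genfun2 \<alpha> q z has_fps_expansion B2_fps z"
  unfolding genfun2_def B2_fps_def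
  by (intro has_fps_expansion_divide' has_fps_expansion_mult E_q_mult_expansion
      E_q_neg_half_expansion g2_expansion q) (simp add: bessel2_fps_nth_0)

lemma B2_conv_B2_fps: "B2 n \<alpha> q z = of_real (qfact q n) * B2_fps z $ n"
  by (simp add: B2_def fps_nth_fps_expansion[OF genfun2_expansion])

text \<open>By the quadratic transformation the denominator is \<open>E * D\<close>. Multiplying the
  quotient by \<open>D\<close> leaves E_q(zt) once the nonzero series \<open>E\<close> is
  cancelled.\<close>

lemma B2_fps_mult_qquot_fps:
  "B2_fps z * fps_of_real (qscale ((1 - q) / 2) (qquot_fps \<alpha> q)) =
   Abs_fps (\<lambda>n. of_real (qPsi q n) * z ^ n)"
proof -
  define E where "E = fps_of_real (qscale ((1 - q) / 2) (qexp_fps q))"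
  define D where "D = fps_of_real (qscale ((1 - q) / 2) (qquot_fps \<alpha> q))"
  define G where "G = fps_of_real (qscale ((1 - q) / 2) (bessel2_fps \<alpha> q))"
  define Z where "Z = Abs_fps (\<lambda>n. of_real (qPsi q n) * z ^ n)"
  have "G = E * D"
    unfolding G_def E_def D_def
    by (simp only: fps_of_real_mult[symmetric] qscale_mult[symmetric] qexp_fps_mult_qquot_fps[OF q \<alpha>])
  moreover have "G $ 0 \<noteq> 0"
    by (simp add: G_def bessel2_fps_nth_0)
  then have "B2_fps z * G = Z * E"
    by (simp add: B2_fps_def Z_def E_def G_def[symmetric] fps_divide_unit mult.assoc inverse_mult_eq_1)
  ultimately have "E * (B2_fps z * D) = E * Z" by (simp add: mult_ac)
  moreover have "E $ 0 \<noteq> 0"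
    by (simp add: E_def qexp_fps_def)
  then have "E \<noteq> 0" by auto
  ultimately show ?thesis by (simp add: D_def Z_def)
qed

text \<open>The connection formula: comparing coefficients of t^n expresses the monomial z^n through
  the polynomials of degree index at most n.\<close>

lemma qPsi_power_conv_sum:
  "of_real (qPsi q n) * z ^ n =
   (\<Sum>k=0..n. B2_fps z $ k * fps_of_real (qscale ((1 - q) / 2) (qquot_fps \<alpha> q)) $ (n - k))"
  using arg_cong[OF B2_fps_mult_qquot_fps, of "\<lambda>F. F $ n"] by (simp add: fps_mult_nth)

text \<open>The generating function is holomorphic for |t| < j/(1-q), whatever z is, because its
  denominator has no zero there.\<close>

lemma B2_fps_summable:
  assumes j: "smallest_pos_zero (jackson2 \<alpha> q) j" and \<rho>: "0 \<le> \<rho>" "\<rho> < j / (1 - q)"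
  shows "summable (\<lambda>n. norm (B2_fps z $ n) * \<rho> ^ n)"
proof -
  have "g2 \<alpha> q (\<i> * t) \<noteq> 0" if "norm t < j / (1 - q)" for t
    unfolding g2_def using q that
    by (intro jackson2_zero_free[OF q \<alpha> j]) (simp add: norm_mult field_simps flip: of_real_diff)
  then have hol: "genfun2 \<alpha> q z holomorphic_on eball 0 (ereal (j / (1 - q)))"
    unfolding genfun2_def
    by (intro holomorphic_intros g2_holomorphic
        holomorphic_on_compose_gen[OF _ E_q_holomorphic[OF q], unfolded o_def, where t = UNIV]) auto
  \<comment> \<open>Convergence at a slightly larger radius gives absolute convergence at
    \<rho>.\<close>
  obtain R where R: "\<rho> < R" "R < j / (1 - q)"
    using \<rho> dense by blast
  have "summable (\<lambda>n. B2_fps z $ n * of_real R ^ n)"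
    using has_fps_expansion_imp_sums_complex[OF genfun2_expansion hol, of "of_real R"] R \<rho>
    by (auto simp: sums_iff)
  then have "summable (\<lambda>n. norm (B2_fps z $ n * of_real \<rho> ^ n))"
    by (rule powser_insidea) (use R \<rho> in auto)
  then show ?thesis using \<rho> by (simp add: norm_mult norm_power)
qed

text \<open>The coefficient ratios of D tend to 1, so D converges for |x| < 1, which is |t| <
  2/(1-q): the other bound on \<tau>.\<close>

lemma qquot_fps_summable:
  assumes \<rho>: "0 \<le> \<rho>" "\<rho> < 2 / (1 - q)"
  shows "summable (\<lambda>n. norm (fps_of_real (qscale ((1 - q) / 2) (qquot_fps \<alpha> q)) $ n) * \<rho> ^ n)"
proof -
  define b where "b = q powr (2 * \<alpha>)"
  define s where "s = (1 - q) / 2"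
  define r where "r n = (1 - b * q ^ Suc (2 * n)) / ((1 - q ^ Suc n) * (1 - b * q ^ Suc n))" for n
  have s: "0 < s" "s * \<rho> < 1"
    using q \<rho> by (simp_all add: s_def field_simps)
  have "(\<lambda>n. q ^ Suc (2 * n)) \<longlonglongrightarrow> 0"
  proof -
    have "(\<lambda>n. q * (q\<^sup>2) ^ n) \<longlonglongrightarrow> q * 0"
      using bessel_params(1,2)[OF q \<alpha>] by (intro tendsto_intros LIMSEQ_power_zero) auto
    then show ?thesis by (simp add: power_mult)
  qed
  then have "r \<longlonglongrightarrow> (1 - b * 0) / ((1 - 0) * (1 - b * 0))"
    unfolding r_def using q by (intro tendsto_intros power_Suc_LIMSEQ_zero) auto
  then have r: "r \<longlonglongrightarrow> 1" by simp
  \<comment> \<open>Solving for the next coefficient divides by the factor with index n + 1, which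
    is known to be positive once n \<ge> 1.\<close>
  have "eventually (\<lambda>n. qquot_fps \<alpha> q $ Suc n = r n * qquot_fps \<alpha> q $ n) sequentially"
    using eventually_ge_at_top[of 1]
  proof eventually_elim
    case (elim n)
    have "0 < 1 - b * q ^ Suc n"
      unfolding b_def by (rule qquot_denom_pos[OF q \<alpha>]) (use elim in simp)
    then have "qquot \<alpha> q (Suc n) = qquot \<alpha> q n * (1 - b * q ^ Suc (2 * n)) / (1 - b * q ^ Suc n)"
      using qquot_Suc[OF q \<alpha>, of n] by (simp only: b_def[symmetric] eq_divide_eq) simp
    then show ?case
      unfolding qquot_fps_def fps_nth_Abs_fps r_def by (simp add: qpoch_Suc mult_ac)
  qed
  then have "summable (\<lambda>n. norm (of_real (qquot_fps \<alpha> q $ n) * (of_real (s * \<rho>) :: complex) ^ n))"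
    by (rule summable_power_series_ratio[OF _ r]) (use s \<rho> in \<open>simp add: norm_mult\<close>)
  then show ?thesis
    using s \<rho> unfolding s_def[symmetric]
    by (simp add: norm_mult norm_power power_mult_distrib mult_ac)
qed

text \<open>With k = n + m, (q;q)_k q^(-k(k-1)/2) is (1-q)^k / Psi_k. Of (1-q)^k, the part (1-q)^m
  is the scaling of D and (1-q)^n cancels the prefactor of L_n.\<close>

lemma L2_term_conv:
  "L2_term \<alpha> q a n m = of_real ((1 - q) ^ n) * (a (n + m) / of_real (qPsi q (n + m)) *
     fps_of_real (qscale ((1 - q) / 2) (qquot_fps \<alpha> q)) $ m)"
proof -
  define u v where "u = (1 - q) ^ n" and "v = (1 - q) ^ m"
  have uv: "(1 - q) ^ (n + m) = u * v" "u \<noteq> 0" "v \<noteq> 0"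
    using q by (simp_all add: u_def v_def power_add)
  have "qpoch q q (n + m) * qquot \<alpha> q m * (1 / 2) ^ m /
      (q ^ ((n + m) * (n + m - 1) div 2) * qpoch q q m) =
     u * (1 / qPsi q (n + m) * (((1 - q) / 2) ^ m * qquot_fps \<alpha> q $ m))"
    unfolding qPsi_conv_qpoch[OF q] uv qquot_fps_def power_divide v_def[symmetric]
    using uv by simp
  then have "L2_term \<alpha> q a n m = a (n + m) *
      of_real (u * (1 / qPsi q (n + m) * (((1 - q) / 2) ^ m * qquot_fps \<alpha> q $ m)))"
    by (simp only: L2_term_def Let_def)
  then show ?thesis by (simp add: u_def)
qed

end

section \<open>Expansion of \<open>f\<close> in the polynomials\<close>

theorem theorem4p5:
  fixes q \<alpha> j \<tau> :: real and a :: "nat \<Rightarrow> complex" and f :: "complex \<Rightarrow> complex"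
  assumes "0 < q" and "q < 1" and "\<alpha> > -1"
    and "smallest_pos_zero (jackson2 \<alpha> q) j"
    and "\<And>z. (\<lambda>n. a n * z ^ n) sums f z"
    and "(\<lambda>n. root n (norm (a n / of_real (qPsi q n)))) \<longlonglongrightarrow> \<tau>"
    and "0 \<le> \<tau>" and "\<tau> < min (2 / (1 - q)) (j / (1 - q))"
  shows "(\<forall>n. summable (L2_term \<alpha> q a n)) \<and>
         (\<forall>z. (\<lambda>n. L2 \<alpha> q a n * B2 n \<alpha> q z / of_real (qfact q n)) sums f z)"
proof -
  note q = assms(1,2) and \<alpha> = assms(3)
  \<comment> \<open>Dividing by Psi_n compensates the factor Psi_n in the connection formula for
    z^n.\<close>
  define c where "c n = a n / of_real (qPsi q n)" for n
  define \<delta> where "\<delta> n = fps_of_real (qscale ((1 - q) / 2) (qquot_fps \<alpha> q)) $ n" for n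
  \<comment> \<open>One radius serves three purposes: above \<tau> it bounds \<open>c\<close>, below
    2/(1-q) it makes D converge, below j/(1-q) the generating function, uniformly in the choice of
    z.\<close>
  obtain \<rho> where \<rho>: "\<tau> < \<rho>" "\<rho> < min (2 / (1 - q)) (j / (1 - q))"
    using assms(8) dense by blast
  then have \<rho>0: "0 < \<rho>" using assms(7) by simp
  obtain C where C: "\<And>n. norm (c n) \<le> C * \<rho> ^ n"
    using root_tendsto_imp_power_bound[OF assms(6) \<rho>(1) \<rho>0] unfolding c_def by blast
  have \<delta>: "summable (\<lambda>n. norm (\<delta> n) * \<rho> ^ n)"
    unfolding \<delta>_def using \<rho> \<rho>0 by (intro qquot_fps_summable q \<alpha>) auto
  have B: "summable (\<lambda>n. norm (B2_fps q \<alpha> z $ n) * \<rho> ^ n)" for z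
    using \<rho> \<rho>0 by (intro B2_fps_summable[OF q \<alpha> assms(4)]) auto
  have "a n * z ^ n = c n * (\<Sum>k=0..n. B2_fps q \<alpha> z $ k * \<delta> (n - k))" for n z
    using qPsi_pos[OF q, of n]
    unfolding \<delta>_def qPsi_power_conv_sum[OF q \<alpha>, symmetric] c_def by simp
  then have S: "(\<lambda>n. c n * (\<Sum>k=0..n. B2_fps q \<alpha> z $ k * \<delta> (n - k))) sums f z" for z
    using assms(5)[of z] by simp
  note rearrange = summable_Cauchy_rearrange[OF C less_imp_le[OF \<rho>0] \<delta> B S]
  have L: "L2_term \<alpha> q a n = (\<lambda>m. of_real ((1 - q) ^ n) * (c (n + m) * \<delta> m))" for n
    by (rule ext) (simp only: L2_term_conv[OF q \<alpha>] c_def \<delta>_def)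
  have "L2 \<alpha> q a n = (\<Sum>m. c (n + m) * \<delta> m)" for n
    unfolding L2_def L using q by (subst suminf_mult[OF rearrange(1)]) simp
  moreover have "B2 n \<alpha> q z / of_real (qfact q n) = B2_fps q \<alpha> z $ n" for n z
    using qfact_pos[OF q, of n] by (simp add: B2_conv_B2_fps[OF q \<alpha>])
  ultimately have "(\<lambda>n. L2 \<alpha> q a n * B2 n \<alpha> q z / of_real (qfact q n)) sums f z" for z
    using rearrange(2)[of z] by (simp only: times_divide_eq_right[symmetric])
  moreover have "summable (L2_term \<alpha> q a n)" for n
    unfolding L by (intro summable_mult rearrange(1))
  ultimately show ?thesis by blast
qed

end
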